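(* Let $n\ge2$, let $\nu$ be a Lévy measure on $\mathbb R$ with $\nu(\mathbb R)=+\infty$ and $\int_{\mathbb R}|y|^n\nu(dy)<\infty$, and let $m_k=\int_{\mathbb R}y^k\nu(dy)$, $2\le k\le n$. Let $\Lambda\ge\min_{\bar\nu\in\mathcal M_{n-1}}\bar\nu(\mathbb R)$. Then the problem $(\Omega_{n,\Lambda})$ admits a solution: there is a measure $\bar\nu^*\in\mathcal M$ satisfying $$\bar\nu^*(\mathbb R)=\Lambda\quad\text{and}\quad\int_{\mathbb R}y^k\bar\nu^*(dy)=m_k,\ k=2,\dots,n-1,$$ at which the functional $J(\bar\nu)=\int_{\mathbb R}|y|^n|\nu-\bar\nu|(dy)$ attains its minimum over all $\bar\nu\in\mathcal M$ satisfying these constraints.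
   Context: $\mathcal M$ is the set of all positive finite measures on $\mathbb R$. For $n\ge2$, $\mathcal M_n=\{\bar\nu\in\mathcal M:\int_{\mathbb R}y^k\bar\nu(dy)=m_k,\ k=2,\dots,n\}$, and by convention $\min_{\bar\nu\in\mathcal M_1}\bar\nu(\mathbb R)=0$. For $n\ge3$ the condition $\Lambda\ge\min_{\bar\nu\in\mathcal M_{n-1}}\bar\nu(\mathbb R)$ is understood literally, i.e. there is some $\bar\nu\in\mathcal M_{n-1}$ with $\bar\nu(\mathbb R)\le\Lambda$ (equivalently, adding mass at $0$, the constraints are feasible); for $n=2$ it means $\Lambda\ge0$. $|\nu-\bar\nu|$ denotes the total variation measure of $\nu-\bar\nu$ (a Lévy measure gives no mass to $\{0\}$, and the integrand $|y|^n$ vanishes at $0$). Problem $(\Omega_{n,\Lambda})$ is: minimize $J(\bar\nu)$ over $\bar\nu\in\mathcal M$ subject to $\bar\nu(\mathbb R)=\Lambda$ and $\int y^k\bar\nu(dy)=m_k$ for $k=2,\dots,n-1$. *)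

theory Defs
  imports "HOL-Analysis.Analysis"
begin

definition levy_measure :: "real measure \<Rightarrow> bool" where
  "levy_measure \<nu> \<longleftrightarrow>
     sets \<nu> = sets borel \<and> emeasure \<nu> {0} = 0 \<and> (\<integral>\<^sup>+ y. ennreal (min 1 (y\<^sup>2)) \<partial>\<nu>) < \<infinity>"

definition finite_measures :: "real measure set" where
  "finite_measures = {\<mu>. sets \<mu> = sets borel \<and> finite_measure \<mu>}"

text \<open>
  The Bochner integral of a non-integrable function is \<open>0\<close>, so integrability has to be
  demanded along with the value of each moment.
\<close>

definition has_moments :: "(nat \<Rightarrow> real) \<Rightarrow> nat \<Rightarrow> real measure \<Rightarrow> bool" where
  "has_moments m n \<mu> \<longleftrightarrow>
     (\<forall>k\<in>{2..n}. integrable \<mu> (\<lambda>y. y ^ k) \<and> (LINT y|\<mu>. y ^ k) = m k)"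

definition moment_class :: "(nat \<Rightarrow> real) \<Rightarrow> nat \<Rightarrow> real measure set" where
  "moment_class m n = {\<mu> \<in> finite_measures. has_moments m n \<mu>}"

definition admissible :: "(nat \<Rightarrow> real) \<Rightarrow> nat \<Rightarrow> real \<Rightarrow> real measure set" where
  "admissible m n \<Lambda> = {\<mu> \<in> finite_measures. measure \<mu> UNIV = \<Lambda> \<and> has_moments m (n - 1) \<mu>}"

text \<open>
  The set function \<open>\<bar>(M - N) A\<bar>\<close>, computed in the extended reals: \<open>M\<close> may be infinite, and the
  difference is the intended one as long as \<open>N\<close> is finite.
\<close>

definition abs_diff :: "'a measure \<Rightarrow> 'a measure \<Rightarrow> 'a set \<Rightarrow> ennreal" where
  "abs_diff M N A = e2ennreal \<bar>enn2ereal (emeasure M A) - enn2ereal (emeasure N A)\<bar>"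

definition countable_partitions :: "'a measure \<Rightarrow> 'a set \<Rightarrow> (nat \<Rightarrow> 'a set) set" where
  "countable_partitions M A = {P. range P \<subseteq> sets M \<and> disjoint_family P \<and> (\<Union>i. P i) = A}"

definition total_variation :: "'a measure \<Rightarrow> 'a measure \<Rightarrow> 'a set \<Rightarrow> ennreal" where
  "total_variation M N A = (SUP P \<in> countable_partitions M A. \<Sum>i. abs_diff M N (P i))"

text \<open>
  The measure \<open>\<bar>M - N\<bar>\<close>. Since \<^const>\<open>measure_of\<close> yields the null measure on a set function that is
  not countably additive, \<open>emeasure_tv_measure\<close> below confirms that this is not the case here.
\<close>

definition tv_measure :: "'a measure \<Rightarrow> 'a measure \<Rightarrow> 'a measure" where
  "tv_measure M N = measure_of (space M) (sets M) (total_variation M N)"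

definition J :: "nat \<Rightarrow> real measure \<Rightarrow> real measure \<Rightarrow> ennreal" where
  "J n \<nu> \<mu> = (\<integral>\<^sup>+ y. ennreal (\<bar>y\<bar> ^ n) \<partial>tv_measure \<nu> \<mu>)"

lemma le_add_abs_diff1:
  assumes "emeasure N A < \<infinity>"
  shows "emeasure M A \<le> emeasure N A + abs_diff M N A"
  using assms unfolding abs_diff_def
  by (cases "emeasure M A"; cases "emeasure N A")
     (auto simp: enn2ereal_ennreal ennreal_plus[symmetric] e2ennreal_ereal
           simp del: ennreal_plus)

lemma le_add_abs_diff2: "emeasure N A \<le> emeasure M A + abs_diff M N A"
  unfolding abs_diff_def
  by (cases "emeasure M A"; cases "emeasure N A")
     (auto simp: enn2ereal_ennreal ennreal_plus[symmetric] e2ennreal_ereal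
           simp del: ennreal_plus)

lemma abs_diff_leI:
  assumes "emeasure M A \<le> emeasure N A + d" "emeasure N A \<le> emeasure M A + d"
    and "emeasure N A < \<infinity>"
  shows "abs_diff M N A \<le> d"
  using assms unfolding abs_diff_def
  by (cases "emeasure M A"; cases "emeasure N A"; cases d)
     (auto simp: enn2ereal_ennreal ennreal_plus[symmetric] e2ennreal_ereal top_unique
           simp del: ennreal_plus)

lemma abs_diff_empty [simp]: "abs_diff M N {} = 0"
  by (simp add: abs_diff_def zero_ennreal.rep_eq zero_ennreal_def[symmetric])

lemma abs_diff_le_suminf:
  assumes "finite_measure N" "sets N = sets M" "range P \<subseteq> sets M" "disjoint_family P"
  shows "abs_diff M N (\<Union>i. P i) \<le> (\<Sum>i. abs_diff M N (P i))"
proof -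
  interpret N: finite_measure N by fact
  have M: "emeasure M (\<Union>i. P i) = (\<Sum>i. emeasure M (P i))"
    using assms by (simp add: suminf_emeasure)
  have N: "emeasure N (\<Union>i. P i) = (\<Sum>i. emeasure N (P i))"
    using assms by (simp add: suminf_emeasure)
  have fin: "emeasure N A < \<infinity>" for A
    by (simp add: less_top[symmetric])
  show ?thesis
  proof (rule abs_diff_leI)
    show "emeasure M (\<Union>i. P i) \<le> emeasure N (\<Union>i. P i) + (\<Sum>i. abs_diff M N (P i))"
      unfolding M N suminf_add[OF summableI summableI]
      by (intro suminf_le summableI le_add_abs_diff1 fin)
    show "emeasure N (\<Union>i. P i) \<le> emeasure M (\<Union>i. P i) + (\<Sum>i. abs_diff M N (P i))"
      unfolding M N suminf_add[OF summableI summableI]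
      by (intro suminf_le summableI le_add_abs_diff2)
  qed (rule fin)
qed

lemma total_variation_superadditive:
  assumes "A \<in> sets M" "B \<in> sets M" "A \<inter> B = {}"
  shows "total_variation M N A + total_variation M N B \<le> total_variation M N (A \<union> B)"
proof -
  have ne: "countable_partitions M C \<noteq> {}" if "C \<in> sets M" for C
  proof -
    have "(\<lambda>i::nat. if i = 0 then C else {}) \<in> countable_partitions M C"
      using that by (auto simp: countable_partitions_def disjoint_family_on_def split: if_splits)
    then show ?thesis by blast
  qed
  have *: "(\<Sum>i. abs_diff M N (P i)) + (\<Sum>i. abs_diff M N (Q i)) \<le> total_variation M N (A \<union> B)"
    if P: "P \<in> countable_partitions M A" and Q: "Q \<in> countable_partitions M B" for P Q
  proof -
    define G where "G = (\<lambda>(j::nat, i). if j = 0 then P i else if j = 1 then Q i else {})"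
    have dP: "x \<in> P i \<Longrightarrow> x \<in> P k \<Longrightarrow> i = k" and dQ: "x \<in> Q i \<Longrightarrow> x \<in> Q k \<Longrightarrow> i = k" for x i k
      using P Q unfolding countable_partitions_def disjoint_family_on_def mem_Collect_eq
      by (metis UNIV_I disjoint_iff)+
    have UP: "(\<Union>i. P i) = A" and UQ: "(\<Union>i. Q i) = B"
      using P Q by (auto simp: countable_partitions_def)
    have dPQ: "\<not> (x \<in> P i \<and> x \<in> Q k)" for x i k
      using UP UQ assms(3) by blast
    have inj: "p = q" if "x \<in> G p" "x \<in> G q" for x p q
      using that dP dQ dPQ by (auto simp: G_def split: prod.splits if_splits)
    have disj: "disjoint_family (G \<circ> prod_decode)"
      unfolding disjoint_family_on_def using inj by (metis comp_apply disjoint_iff prod_decode_eq)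
    have "(\<Union>p. G p) = A \<union> B"
    proof
      show "(\<Union>p. G p) \<subseteq> A \<union> B"
        using UP UQ by (auto simp: G_def split: if_splits)
      have "P i = G (0, i)" "Q i = G (1, i)" for i
        by (simp_all add: G_def)
      then have "P i \<subseteq> (\<Union>p. G p)" "Q i \<subseteq> (\<Union>p. G p)" for i
        using UN_upper[of "(0, i)" UNIV G] UN_upper[of "(1, i)" UNIV G] by simp_all
      then show "A \<union> B \<subseteq> (\<Union>p. G p)"
        using UP UQ by blast
    qed
    then have un: "(\<Union>n. (G \<circ> prod_decode) n) = A \<union> B"
      by (metis image_comp surj_prod_decode)
    have "range (G \<circ> prod_decode) \<subseteq> sets M"
      using P Q by (auto simp: G_def countable_partitions_def split: prod.splits)
    with disj un have G: "G \<circ> prod_decode \<in> countable_partitions M (A \<union> B)"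
      by (auto simp: countable_partitions_def)
    have "(\<Sum>n. abs_diff M N ((G \<circ> prod_decode) n)) = (\<Sum>j. \<Sum>i. abs_diff M N (G (j, i)))"
      using suminf_ennreal_2dimen[of "\<lambda>j. \<Sum>i. abs_diff M N (G (j, i))" "\<lambda>p. abs_diff M N (G p)"]
      by (simp add: comp_def)
    also have "\<dots> = (\<Sum>j\<in>{0, 1}. \<Sum>i. abs_diff M N (G (j, i)))"
      by (rule suminf_finite) (auto simp: G_def)
    also have "\<dots> = (\<Sum>i. abs_diff M N (P i)) + (\<Sum>i. abs_diff M N (Q i))"
      by (simp add: G_def)
    finally show ?thesis
      using SUP_upper[OF G, of "\<lambda>P. \<Sum>i. abs_diff M N (P i)"]
      by (simp only: total_variation_def)
  qed
  have "(\<Sum>i. abs_diff M N (P i)) + total_variation M N B \<le> total_variation M N (A \<union> B)"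
    if "P \<in> countable_partitions M A" for P
    unfolding total_variation_def[of M N B] ennreal_SUP_add_right[OF ne[OF assms(2)]]
    by (intro SUP_least * that)
  then show ?thesis
    unfolding total_variation_def[of M N A] ennreal_SUP_add_left[OF ne[OF assms(1)], symmetric]
    by (intro SUP_least)
qed

lemma total_variation_countably_additive:
  assumes "finite_measure N" "sets N = sets M"
  shows "countably_additive (sets M) (total_variation M N)"
proof (rule countably_additiveI)
  fix F :: "nat \<Rightarrow> 'a set"
  assume F: "range F \<subseteq> sets M" "disjoint_family F" "(\<Union>i. F i) \<in> sets M"
  let ?t = "total_variation M N"
  have part: "(\<Sum>i. abs_diff M N (P i)) \<le> (\<Sum>j. ?t (F j))"
    if P: "P \<in> countable_partitions M (\<Union>i. F i)" for P
  proof -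
    have Ps: "range P \<subseteq> sets M" "disjoint_family P" and PU: "(\<Union>i. P i) = (\<Union>i. F i)"
      using P by (auto simp: countable_partitions_def)
    have "abs_diff M N (P i) \<le> (\<Sum>j. abs_diff M N (P i \<inter> F j))" for i
    proof -
      have "(\<Union>j. P i \<inter> F j) = P i" using PU by blast
      moreover have "abs_diff M N (\<Union>j. P i \<inter> F j) \<le> (\<Sum>j. abs_diff M N (P i \<inter> F j))"
        using F Ps by (intro abs_diff_le_suminf assms) (auto simp: disjoint_family_on_def)
      ultimately show ?thesis by simp
    qed
    then have "(\<Sum>i. abs_diff M N (P i)) \<le> (\<Sum>i. \<Sum>j. abs_diff M N (P i \<inter> F j))"
      by (intro suminf_le summableI)
    also have "\<dots> = (\<Sum>j. \<Sum>i. abs_diff M N (P i \<inter> F j))"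
    proof -
      have "(\<Sum>i. \<Sum>j. f i j) = (\<Sum>j. \<Sum>i. f i j)" for f :: "nat \<Rightarrow> nat \<Rightarrow> ennreal"
        by (subst (1 2) nn_integral_count_space_nat[symmetric])
           (simp add: nn_integral_suminf)
      then show ?thesis .
    qed
    also have "\<dots> \<le> (\<Sum>j. ?t (F j))"
    proof (intro suminf_le summableI)
      fix j
      have "(\<lambda>i. P i \<inter> F j) \<in> countable_partitions M (F j)"
        using F(1) Ps PU[symmetric]
        by (auto simp: countable_partitions_def intro: disjoint_family_on_bisimulation[OF Ps(2)])
      then show "(\<Sum>i. abs_diff M N (P i \<inter> F j)) \<le> ?t (F j)"
        unfolding total_variation_def by (rule SUP_upper)
    qed
    finally show ?thesis .
  qed
  have fin: "(\<Sum>j<k. ?t (F j)) \<le> ?t (\<Union>j<k. F j)" for k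
  proof (induction k)
    case (Suc k)
    have d: "(\<Union>j<k. F j) \<inter> F k = {}"
    proof -
      have "F j \<inter> F k = {}" if "j < k" for j
        using F(2) that by (intro disjoint_family_onD[where I = UNIV]) auto
      then show ?thesis by auto
    qed
    have "(\<Sum>j<Suc k. ?t (F j)) \<le> ?t (\<Union>j<k. F j) + ?t (F k)"
      using Suc by (simp add: add_mono)
    also have "\<dots> \<le> ?t ((\<Union>j<k. F j) \<union> F k)"
      using F d by (intro total_variation_superadditive) auto
    also have "(\<Union>j<k. F j) \<union> F k = (\<Union>j<Suc k. F j)"
      by (auto simp: lessThan_Suc)
    finally show ?case .
  qed simp
  have "(\<Sum>j<k. ?t (F j)) \<le> ?t (\<Union>i. F i)" for k
  proof -
    let ?A = "\<Union>j<k. F j"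
    have A: "?A \<in> sets M" using F by auto
    have "?t ?A \<le> ?t ?A + ?t ((\<Union>i. F i) - ?A)" by simp
    also have "\<dots> \<le> ?t (?A \<union> ((\<Union>i. F i) - ?A))"
      using A F(3) by (intro total_variation_superadditive) auto
    also have "?A \<union> ((\<Union>i. F i) - ?A) = (\<Union>i. F i)" by auto
    finally show ?thesis using fin[of k] by (rule order_trans[rotated])
  qed
  then have "(\<Sum>j. ?t (F j)) \<le> ?t (\<Union>i. F i)"
    by (intro suminf_le_const summableI)
  moreover have "?t (\<Union>i. F i) \<le> (\<Sum>j. ?t (F j))"
    unfolding total_variation_def[of M N "\<Union>i. F i"] by (intro SUP_least part)
  ultimately show "(\<Sum>j. ?t (F j)) = ?t (\<Union>i. F i)" by (rule antisym)
qed

lemma space_tv_measure [simp]: "space (tv_measure M N) = space M"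
  and sets_tv_measure [simp, measurable_cong]: "sets (tv_measure M N) = sets M"
  by (simp_all add: tv_measure_def)

lemma emeasure_tv_measure:
  assumes "finite_measure N" "sets N = sets M" "A \<in> sets M"
  shows "emeasure (tv_measure M N) A = total_variation M N A"
proof (rule emeasure_measure_of[OF tv_measure_def])
  have "(\<Sum>i. abs_diff M N (P i)) = 0" if "P \<in> countable_partitions M {}" for P
    using that by (auto simp: countable_partitions_def)
  then show "positive (sets (tv_measure M N)) (total_variation M N)"
    by (auto simp: positive_def total_variation_def bot_ennreal[symmetric] intro!: SUP_eq_const
        simp: SUP_bot_conv)
  show "countably_additive (sets (tv_measure M N)) (total_variation M N)"
    using assms by (simp add: total_variation_countably_additive)
qed (use assms sets.space_closed in auto)

end

theory Submission
  imports Defs "HOL-Probability.Helly_Selection" "HOL-Probability.Giry_Monad"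
begin

text \<open>
  The proof is the direct method of the calculus of variations. The constraints are feasible, because
  mass can be added at \<open>0\<close> without changing moments of order at least \<open>2\<close>
  (\<open>has_moments_add_mass_at_0\<close>). If \<open>J\<close> is infinite on all admissible measures, each of them is a
  minimizer. Otherwise take a minimizing sequence \<open>\<mu> i\<close>. As \<open>\<mu> i \<le> \<nu> + \<bar>\<nu> - \<mu> i\<bar>\<close>, the integrals of
  \<open>\<bar>y\<bar> ^ n\<close> against \<open>\<mu> i\<close> are bounded by some \<open>K\<close>. Hence the sequence is tight, and as all its members have
  mass \<open>\<Lambda>\<close>, a subsequence converges weakly to a measure \<open>\<mu>\<^sub>0\<close> of mass \<open>\<Lambda>\<close>
  (\<open>finite_measures_weakly_compact\<close>).

  The limit is admissible: the bound \<open>K\<close> makes all powers of order less than \<open>n\<close> uniformly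
  integrable, so that their integrals converge (\<open>weak_limit_integral_dominated\<close>). The moment of order
  \<open>n\<close> can change in the limit, but it is not prescribed.

  The limit is optimal because \<open>J\<close> is lower semicontinuous, being a supremum of weakly continuous
  functionals: \<open>\<integral>\<bar>y\<bar> ^ n d\<bar>\<nu> - \<mu>\<bar>\<close> is the supremum of \<open>\<integral>f d\<nu> - \<integral>f d\<mu>\<close> over continuous bounded \<open>f\<close> with
  \<open>\<bar>f y\<bar> \<le> \<bar>y\<bar> ^ n\<close> (\<open>integral_diff_le_tv\<close> and \<open>nn_integral_tv_le_dual\<close>). That \<open>\<nu>\<close> is infinite near \<open>0\<close>
  does no harm, because \<open>\<bar>y\<bar> ^ n \<nu>\<close> is finite: the Hahn decomposition, the regularity and the
  approximation by continuous functions are those of the weighted measures.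
\<close>

section \<open>Integrals against the total variation of a difference\<close>

text \<open>
  A setwise inequality between two sums of measures passes to integrals, because both sides are
  limits of integrals of one common sequence of simple functions. The inequality is only assumed
  below \<open>S\<close>, so that it applies to the two halves of a Hahn decomposition separately; with null
  measures in two of the four places it also compares one measure with a sum, or with one other.
\<close>

lemma nn_integral_add_mono:
  fixes f :: "'a \<Rightarrow> ennreal"
  assumes sets: "sets B = sets A" "sets C = sets A" "sets D = sets A"
    and le: "\<And>X. X \<in> sets A \<Longrightarrow> X \<subseteq> S \<Longrightarrow> emeasure A X + emeasure B X \<le> emeasure C X + emeasure D X"
    and f: "f \<in> borel_measurable A" and off: "\<And>x. x \<notin> S \<Longrightarrow> f x = 0"
  shows "(\<integral>\<^sup>+x. f x \<partial>A) + (\<integral>\<^sup>+x. f x \<partial>B) \<le> (\<integral>\<^sup>+x. f x \<partial>C) + (\<integral>\<^sup>+x. f x \<partial>D)"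
proof -
  obtain s where s: "\<And>i. simple_function A (s i)" "incseq s" "\<And>x. (SUP i. s i x) = f x"
    using borel_measurable_implies_simple_function_sequence'[OF f] by metis
  have sp: "space B = space A" "space C = space A" "space D = space A"
    using sets by (auto dest: sets_eq_imp_space_eq)
  have eq: "(\<integral>\<^sup>+x. s i x \<partial>X) = (\<Sum>y\<in>s i ` space A. y * emeasure X (s i -` {y} \<inter> space A))"
    if X: "sets X = sets A" for X i
  proof -
    have "simple_function X (s i)"
      using s(1)[of i] X by (simp add: simple_function_def sets_eq_imp_space_eq[OF X])
    then show ?thesis
      by (simp add: nn_integral_eq_simple_integral simple_integral_def sets_eq_imp_space_eq[OF X])
  qed
  have sup: "(\<integral>\<^sup>+x. f x \<partial>X) = (SUP i. \<integral>\<^sup>+x. s i x \<partial>X)" if "sets X = sets A" for X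
    unfolding s(3)[symmetric]
    using borel_measurable_simple_function[OF s(1)] that
    by (intro nn_integral_monotone_convergence_SUP s(2)) (simp cong: measurable_cong_sets)
  have inc: "incseq (\<lambda>i. \<integral>\<^sup>+x. s i x \<partial>X)" for X
    using s(2) by (auto simp: incseq_def le_fun_def intro!: nn_integral_mono)
  have "(\<integral>\<^sup>+x. s i x \<partial>A) + (\<integral>\<^sup>+x. s i x \<partial>B) \<le> (\<integral>\<^sup>+x. f x \<partial>C) + (\<integral>\<^sup>+x. f x \<partial>D)" for i
  proof -
    have "(\<integral>\<^sup>+x. s i x \<partial>A) + (\<integral>\<^sup>+x. s i x \<partial>B) =
      (\<Sum>y\<in>s i ` space A. y * (emeasure A (s i -` {y} \<inter> space A) + emeasure B (s i -` {y} \<inter> space A)))"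
      by (simp add: eq sets distrib_left sum.distrib)
    also have "\<dots> \<le> (\<Sum>y\<in>s i ` space A. y * (emeasure C (s i -` {y} \<inter> space A) + emeasure D (s i -` {y} \<inter> space A)))"
    proof (rule sum_mono)
      fix y assume "y \<in> s i ` space A"
      show "y * (emeasure A (s i -` {y} \<inter> space A) + emeasure B (s i -` {y} \<inter> space A))
        \<le> y * (emeasure C (s i -` {y} \<inter> space A) + emeasure D (s i -` {y} \<inter> space A))"
      proof (cases "y = 0")
        case False
        \<comment> \<open>Only nonzero values matter, and their level sets lie in \<open>S\<close>.\<close>
        have "s i x = 0" if "x \<notin> S" for x
          using SUP_upper[of i UNIV "\<lambda>i. s i x"] off[OF that] by (simp add: s(3))
        with False have "s i -` {y} \<inter> space A \<subseteq> S" by auto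
        then show ?thesis
          using s(1)[of i] by (intro mult_left_mono le) (auto dest: simple_functionD)
      qed simp
    qed
    also have "\<dots> = (\<integral>\<^sup>+x. s i x \<partial>C) + (\<integral>\<^sup>+x. s i x \<partial>D)"
      by (simp add: eq sets distrib_left sum.distrib)
    also have "\<dots> \<le> (\<integral>\<^sup>+x. f x \<partial>C) + (\<integral>\<^sup>+x. f x \<partial>D)"
      by (intro add_mono nn_integral_mono) (auto simp: s(3)[symmetric] intro: SUP_upper)
    finally show ?thesis .
  qed
  then show ?thesis
    unfolding sup[OF refl] sup[OF sets(1)] ennreal_SUP_add[OF inc inc, symmetric]
    by (intro SUP_least)
qed

lemma abs_diff_le_tv_measure:
  assumes "finite_measure N" "sets N = sets M" "X \<in> sets M"
  shows "abs_diff M N X \<le> emeasure (tv_measure M N) X"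
proof -
  let ?P = "\<lambda>i::nat. if i = 0 then X else {}"
  have "?P \<in> countable_partitions M X"
    using assms by (auto simp: countable_partitions_def disjoint_family_on_def split: if_splits)
  then have "(\<Sum>i. abs_diff M N (?P i)) \<le> total_variation M N X"
    unfolding total_variation_def by (rule SUP_upper)
  moreover have "(\<Sum>i. abs_diff M N (?P i)) = abs_diff M N X"
    by (subst suminf_finite[of "{0}"]) auto
  ultimately show ?thesis
    using assms by (simp add: emeasure_tv_measure)
qed

text \<open>
  For infinite \<open>M\<close> the inequality \<open>\<bar>\<integral>f dM - \<integral>f dN\<bar> \<le> \<integral>f d\<bar>M - N\<bar>\<close> could subtract infinities,
  hence two additive inequalities.
\<close>

lemma nn_integral_le_add_tv:
  fixes f :: "'a \<Rightarrow> ennreal"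
  assumes N: "finite_measure N" "sets N = sets M" and f: "f \<in> borel_measurable M"
  shows "(\<integral>\<^sup>+x. f x \<partial>M) \<le> (\<integral>\<^sup>+x. f x \<partial>N) + (\<integral>\<^sup>+x. f x \<partial>tv_measure M N)"
    and "(\<integral>\<^sup>+x. f x \<partial>N) \<le> (\<integral>\<^sup>+x. f x \<partial>M) + (\<integral>\<^sup>+x. f x \<partial>tv_measure M N)"
proof -
  interpret N: finite_measure N by fact
  have tv: "abs_diff M N X \<le> emeasure (tv_measure M N) X" if "X \<in> sets M" for X
    using abs_diff_le_tv_measure[OF N that] .
  have fin: "emeasure N X < \<infinity>" for X by (simp add: less_top[symmetric])
  have "(\<integral>\<^sup>+x. f x \<partial>M) + (\<integral>\<^sup>+x. f x \<partial>null_measure M) \<le> (\<integral>\<^sup>+x. f x \<partial>N) + (\<integral>\<^sup>+x. f x \<partial>tv_measure M N)"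
    using N f by (intro nn_integral_add_mono[where S=UNIV])
      (auto intro: order_trans[OF le_add_abs_diff1[OF fin]] add_left_mono tv)
  then show "(\<integral>\<^sup>+x. f x \<partial>M) \<le> (\<integral>\<^sup>+x. f x \<partial>N) + (\<integral>\<^sup>+x. f x \<partial>tv_measure M N)" by simp
  have "(\<integral>\<^sup>+x. f x \<partial>N) + (\<integral>\<^sup>+x. f x \<partial>null_measure M) \<le> (\<integral>\<^sup>+x. f x \<partial>M) + (\<integral>\<^sup>+x. f x \<partial>tv_measure M N)"
    using N f by (intro nn_integral_add_mono[where S=UNIV])
      (auto intro: order_trans[OF le_add_abs_diff2] add_left_mono tv cong: measurable_cong_sets)
  then show "(\<integral>\<^sup>+x. f x \<partial>N) \<le> (\<integral>\<^sup>+x. f x \<partial>M) + (\<integral>\<^sup>+x. f x \<partial>tv_measure M N)" by simp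
qed

text \<open>
  The easy half of the duality between \<open>\<bar>M - N\<bar>\<close> and test functions: \<open>f\<^sup>+\<close> is compared through
  \<open>M \<le> N + \<bar>M - N\<bar>\<close> and \<open>f\<^sup>-\<close> through \<open>N \<le> M + \<bar>M - N\<bar>\<close>.
\<close>

lemma integral_diff_le_tv:
  fixes f :: "'a \<Rightarrow> real"
  assumes N: "finite_measure N" "sets N = sets M" and f: "integrable M f" "integrable N f"
  shows "ennreal ((LINT x|M. f x) - (LINT x|N. f x)) \<le> (\<integral>\<^sup>+x. ennreal \<bar>f x\<bar> \<partial>tv_measure M N)"
proof -
  let ?T = "tv_measure M N"
  have fM[measurable]: "f \<in> borel_measurable M" using f(1) by auto
  then have fT[measurable]: "f \<in> borel_measurable ?T" by (simp cong: measurable_cong_sets)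
  have p: "(\<integral>\<^sup>+x. ennreal (max 0 (f x)) \<partial>M) \<le> (\<integral>\<^sup>+x. ennreal (max 0 (f x)) \<partial>N) + (\<integral>\<^sup>+x. ennreal (max 0 (f x)) \<partial>?T)"
    by (intro nn_integral_le_add_tv N) simp
  have q: "(\<integral>\<^sup>+x. ennreal (max 0 (- f x)) \<partial>N) \<le> (\<integral>\<^sup>+x. ennreal (max 0 (- f x)) \<partial>M) + (\<integral>\<^sup>+x. ennreal (max 0 (- f x)) \<partial>?T)"
    by (intro nn_integral_le_add_tv N) simp
  have split: "(\<integral>\<^sup>+x. ennreal \<bar>f x\<bar> \<partial>?T) = (\<integral>\<^sup>+x. ennreal (max 0 (f x)) \<partial>?T) + (\<integral>\<^sup>+x. ennreal (max 0 (- f x)) \<partial>?T)"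
    by (subst nn_integral_add[symmetric])
       (auto intro!: nn_integral_cong simp: max_def simp flip: ennreal_plus)
  have i: "integrable X (\<lambda>x. max 0 (f x))" "integrable X (\<lambda>x. max 0 (- f x))"
    "(LINT x|X. f x) = (LINT x|X. max 0 (f x)) - (LINT x|X. max 0 (- f x))"
    if "integrable X f" for X
  proof -
    show i: "integrable X (\<lambda>x. max 0 (f x))" "integrable X (\<lambda>x. max 0 (- f x))"
      using that by auto
    show "(LINT x|X. f x) = (LINT x|X. max 0 (f x)) - (LINT x|X. max 0 (- f x))"
      by (subst Bochner_Integration.integral_diff[symmetric, OF i]) (auto intro!: Bochner_Integration.integral_cong)
  qed
  have nn: "(\<integral>\<^sup>+x. ennreal (max 0 (g x)) \<partial>X) = ennreal (LINT x|X. max 0 (g x))"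
    if "integrable X (\<lambda>x. max 0 (g x))" for X and g :: "'a \<Rightarrow> real"
    by (intro nn_integral_eq_integral that) simp
  show ?thesis
  proof (cases "(\<integral>\<^sup>+x. ennreal \<bar>f x\<bar> \<partial>?T)")
    case (real t)
    let ?a = "\<integral>\<^sup>+x. ennreal (max 0 (f x)) \<partial>?T" and ?b = "\<integral>\<^sup>+x. ennreal (max 0 (- f x)) \<partial>?T"
    have "?a < top" "?b < top" using real split by (auto simp: less_top[symmetric])
    then obtain a b where ab: "?a = ennreal a" "?b = ennreal b" "0 \<le> a" "0 \<le> b"
      by (cases ?a; cases ?b) auto
    have t: "t = a + b" using real split ab by (simp flip: ennreal_plus)
    have pos: "0 \<le> (LINT x|X. max 0 (g x))" for X and g :: "'a \<Rightarrow> real"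
      by (intro integral_nonneg_AE) simp
    have "(LINT x|M. max 0 (f x)) \<le> (LINT x|N. max 0 (f x)) + a"
      using p pos ab by (simp add: nn i f flip: ennreal_plus)
    moreover have "(LINT x|N. max 0 (- f x)) \<le> (LINT x|M. max 0 (- f x)) + b"
      using q pos ab by (simp add: nn i f flip: ennreal_plus)
    ultimately show ?thesis
      using real t i(3)[OF f(1)] i(3)[OF f(2)] by (auto intro: ennreal_leI)
  qed simp
qed

lemma abs_diff_add_cancel:
  "emeasure N X \<le> emeasure M X \<Longrightarrow> emeasure N X < \<infinity> \<Longrightarrow> abs_diff M N X + emeasure N X = emeasure M X"
  "emeasure M X \<le> emeasure N X \<Longrightarrow> emeasure N X < \<infinity> \<Longrightarrow> abs_diff M N X + emeasure M X = emeasure N X"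
  unfolding abs_diff_def
  by (cases "emeasure M X"; cases "emeasure N X";
      auto simp: enn2ereal_ennreal e2ennreal_ereal top_unique simp flip: ennreal_plus)+

text \<open>
  Where \<open>abs_diff M N\<close> is the difference of two measures, all partitions of \<open>X\<close> yield the same sum
  \<open>U X - L X\<close>. It is used with \<open>(L, U) = (N, M)\<close> and \<open>(M, N)\<close>, on the two parts of a
  Hahn decomposition.
\<close>

lemma tv_measure_add_le:
  assumes N: "finite_measure N" "sets N = sets M" and X: "X \<in> sets M"
    and L: "sets L = sets M"
    and eq: "\<And>Y. Y \<in> sets M \<Longrightarrow> Y \<subseteq> X \<Longrightarrow> abs_diff M N Y + emeasure L Y = emeasure U Y"
    and U: "sets U = sets M"
  shows "emeasure (tv_measure M N) X + emeasure L X \<le> emeasure U X"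
proof -
  have ne: "countable_partitions M X \<noteq> {}"
  proof -
    have "(\<lambda>i::nat. if i = 0 then X else {}) \<in> countable_partitions M X"
      using X by (auto simp: countable_partitions_def disjoint_family_on_def split: if_splits)
    then show ?thesis by blast
  qed
  have "(\<Sum>i. abs_diff M N (P i)) + emeasure L X \<le> emeasure U X"
    if "P \<in> countable_partitions M X" for P
  proof -
    from that have P: "range P \<subseteq> sets M" "disjoint_family P" and PX: "(\<Union>i. P i) = X"
      by (auto simp: countable_partitions_def)
    have "(\<Sum>i. abs_diff M N (P i)) + emeasure L X = (\<Sum>i. abs_diff M N (P i)) + (\<Sum>i. emeasure L (P i))"
      using P by (simp add: suminf_emeasure L PX)
    also have "\<dots> = (\<Sum>i. abs_diff M N (P i) + emeasure L (P i))"
      by (intro suminf_add summableI)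
    also have "\<dots> = (\<Sum>i. emeasure U (P i))"
      using P(1) PX by (intro suminf_cong eq) auto
    also have "\<dots> = emeasure U X"
      using P by (simp add: suminf_emeasure U PX)
    finally show ?thesis by simp
  qed
  then show ?thesis
    unfolding emeasure_tv_measure[OF N X] total_variation_def ennreal_SUP_add_left[OF ne, symmetric]
    by (intro SUP_least)
qed

text \<open>
  The other half of the duality: given a Hahn decomposition of a set off which \<open>w\<close> vanishes, the sign
  function \<open>1\<^sub>P - 1\<^sub>Q\<close> attains \<open>\<integral>w d\<bar>M - N\<bar>\<close>.
\<close>

lemma nn_integral_tv_Hahn:
  fixes w :: "'a \<Rightarrow> real"
  assumes N: "finite_measure N" "sets N = sets M"
    and int: "integrable M w" "integrable N w" and w: "\<And>x. 0 \<le> w x"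
    and PQ: "P \<in> sets M" "Q \<in> sets M" "P \<inter> Q = {}" "\<And>x. x \<notin> P \<union> Q \<Longrightarrow> w x = 0"
    and P: "\<And>X. X \<in> sets M \<Longrightarrow> X \<subseteq> P \<Longrightarrow> emeasure N X \<le> emeasure M X"
    and Q: "\<And>X. X \<in> sets M \<Longrightarrow> X \<subseteq> Q \<Longrightarrow> emeasure M X \<le> emeasure N X"
  shows "(\<integral>\<^sup>+x. ennreal (w x) \<partial>tv_measure M N) \<le>
    ennreal ((LINT x|M. w x * (indicator P x - indicator Q x)) - (LINT x|N. w x * (indicator P x - indicator Q x)))"
proof -
  interpret N: finite_measure N by fact
  note PQ(1,2)[measurable]
  let ?T = "tv_measure M N"
  have fin: "emeasure N X < \<infinity>" for X by (simp add: less_top[symmetric])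
  have [measurable]: "w \<in> borel_measurable M" using int(1) by auto
  then have [measurable]: "w \<in> borel_measurable ?T" by (simp cong: measurable_cong_sets)
  let ?f = "\<lambda>A x. ennreal (w x * indicator A x)"
  have p: "(\<integral>\<^sup>+x. ?f P x \<partial>?T) + (\<integral>\<^sup>+x. ?f P x \<partial>N) \<le> (\<integral>\<^sup>+x. ?f P x \<partial>M) + (\<integral>\<^sup>+x. ?f P x \<partial>null_measure M)"
    using N by (intro nn_integral_add_mono[where S=P])
      (auto intro!: tv_measure_add_le[OF N] abs_diff_add_cancel P fin)
  have q: "(\<integral>\<^sup>+x. ?f Q x \<partial>?T) + (\<integral>\<^sup>+x. ?f Q x \<partial>M) \<le> (\<integral>\<^sup>+x. ?f Q x \<partial>N) + (\<integral>\<^sup>+x. ?f Q x \<partial>null_measure M)"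
    using N by (intro nn_integral_add_mono[where S=Q])
      (auto intro!: tv_measure_add_le[OF N] abs_diff_add_cancel Q fin)
  have i: "integrable M (\<lambda>x. w x * indicator A x)" "integrable N (\<lambda>x. w x * indicator A x)" if "A \<in> sets M" for A
    using that by (auto intro: integrable_real_mult_indicator int simp: N(2))
  have nn: "(\<integral>\<^sup>+x. ?f A x \<partial>X) = ennreal (LINT x|X. w x * indicator A x)"
    if "integrable X (\<lambda>x. w x * indicator A x)" for X A
    by (intro nn_integral_eq_integral that) (simp add: w)
  have pos: "0 \<le> (LINT x|X. w x * indicator A x)" for X A
    by (intro integral_nonneg_AE) (simp add: w)
  let ?a = "\<integral>\<^sup>+x. ?f P x \<partial>?T" and ?b = "\<integral>\<^sup>+x. ?f Q x \<partial>?T"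
  have "?a \<noteq> top" "?b \<noteq> top" using p q by (auto simp: nn i PQ top_unique)
  then obtain a b where ab: "?a = ennreal a" "?b = ennreal b" "0 \<le> a" "0 \<le> b"
    by (cases ?a; cases ?b) auto
  have 1: "a + (LINT x|N. w x * indicator P x) \<le> (LINT x|M. w x * indicator P x)"
    using p pos ab by (simp add: nn i PQ flip: ennreal_plus)
  have 2: "b + (LINT x|M. w x * indicator Q x) \<le> (LINT x|N. w x * indicator Q x)"
    using q pos ab by (simp add: nn i PQ flip: ennreal_plus)
  have "(\<integral>\<^sup>+x. ennreal (w x) \<partial>?T) = ?a + ?b"
    using PQ(3,4) by (subst nn_integral_add[symmetric])
       (auto intro!: nn_integral_cong simp: split: split_indicator)
  also have "\<dots> = ennreal (a + b)" using ab by simp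
  also have "\<dots> \<le> ennreal ((LINT x|M. w x * indicator P x) - (LINT x|M. w x * indicator Q x)
      - ((LINT x|N. w x * indicator P x) - (LINT x|N. w x * indicator Q x)))"
    using 1 2 by (intro ennreal_leI) simp
  finally show ?thesis
    by (simp add: right_diff_distrib i PQ)
qed

text \<open>
  \<open>M\<close> may be infinite, like a Levy measure near \<open>0\<close>, but the weighted measures \<open>w M\<close> and \<open>w N\<close> are
  finite and have a Hahn decomposition. Where \<open>w\<close> is positive, dividing by \<open>w\<close> turns it into one
  for \<open>M\<close> and \<open>N\<close>.
\<close>

lemma weighted_Hahn_decomposition:
  fixes w :: "'a \<Rightarrow> real"
  assumes sets: "sets N = sets M"
    and int: "integrable M w" "integrable N w" and w: "\<And>x. 0 \<le> w x"
  shows "\<exists>P\<in>sets M. \<exists>Q\<in>sets M. P \<inter> Q = {} \<and> P \<union> Q = {x \<in> space M. w x \<noteq> 0} \<and>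
    (\<forall>X\<in>sets M. X \<subseteq> P \<longrightarrow> emeasure N X \<le> emeasure M X) \<and>
    (\<forall>X\<in>sets M. X \<subseteq> Q \<longrightarrow> emeasure M X \<le> emeasure N X)"
proof -
  have wM[measurable]: "w \<in> borel_measurable M" using int(1) by auto
  have wN[measurable]: "w \<in> borel_measurable N" using int(2) by auto
  define D where "D X = density X (\<lambda>x. ennreal (w x))" for X :: "'a measure"
  have fin: "finite_measure (D M)" "finite_measure (D N)"
    using int w by (auto intro!: finite_measureI simp: D_def emeasure_density nn_integral_eq_integral
      cong: nn_integral_cong_simp)
  have s[simp]: "sets (D X) = sets X" "space (D X) = space X" for X by (simp_all add: D_def)
  obtain Y where Y: "Y \<in> sets M" "\<And>X. X \<in> sets M \<Longrightarrow> X \<subseteq> Y \<Longrightarrow> emeasure (D N) X \<le> emeasure (D M) X"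
    "\<And>X. X \<in> sets M \<Longrightarrow> X \<inter> Y = {} \<Longrightarrow> emeasure (D M) X \<le> emeasure (D N) X"
    using finite_unsigned_Hahn_decomposition[OF fin] sets by (auto simp: D_def)
  have rec: "emeasure X Z = (\<integral>\<^sup>+x. ennreal (1 / w x) * indicator Z x \<partial>D X)"
    if [measurable]: "w \<in> borel_measurable X" "Z \<in> sets X" and Z: "Z \<subseteq> {x. w x \<noteq> 0}" for X Z
  proof -
    have "(\<integral>\<^sup>+x. ennreal (1 / w x) * indicator Z x \<partial>D X) =
      (\<integral>\<^sup>+x. ennreal (w x) * (ennreal (1 / w x) * indicator Z x) \<partial>X)"
      unfolding D_def by (intro nn_integral_density) auto
    also have "\<dots> = (\<integral>\<^sup>+x. indicator Z x \<partial>X)"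
      using Z w by (intro nn_integral_cong) (auto simp: simp flip: ennreal_mult' split: split_indicator)
    finally show ?thesis by simp
  qed
  have mono: "emeasure A X \<le> emeasure B X"
    if AB: "sets A = sets M" "sets B = sets M" and [measurable]: "X \<in> sets M" and X: "X \<subseteq> {x. w x \<noteq> 0}"
     and le: "\<And>Z. Z \<in> sets M \<Longrightarrow> Z \<subseteq> X \<Longrightarrow> emeasure (D A) Z \<le> emeasure (D B) Z" for A B X
  proof -
    have [measurable]: "w \<in> borel_measurable A" "w \<in> borel_measurable B"
      using AB wM by (simp_all cong: measurable_cong_sets)
    have [measurable]: "X \<in> sets A" "X \<in> sets B" using AB that by auto
    let ?f = "\<lambda>x. ennreal (1 / w x) * indicator X x"
    have "(\<integral>\<^sup>+x. ?f x \<partial>D A) + (\<integral>\<^sup>+x. ?f x \<partial>null_measure M) \<le> (\<integral>\<^sup>+x. ?f x \<partial>D B) + (\<integral>\<^sup>+x. ?f x \<partial>null_measure M)"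
      using AB X le by (intro nn_integral_add_mono[where S=X]) (auto simp: D_def)
    then show ?thesis
      by (simp add: rec X)
  qed
  define P where "P = {x \<in> space M. w x \<noteq> 0} \<inter> Y"
  define Q where "Q = {x \<in> space M. w x \<noteq> 0} - Y"
  show ?thesis
  proof (rule bexI[of _ P], rule bexI[of _ Q], intro conjI ballI impI)
    show "P \<in> sets M" "Q \<in> sets M" using Y(1) by (auto simp: P_def Q_def)
    show "P \<inter> Q = {}" "P \<union> Q = {x \<in> space M. w x \<noteq> 0}" by (auto simp: P_def Q_def)
    show "emeasure N X \<le> emeasure M X" if "X \<in> sets M" "X \<subseteq> P" for X
      using that by (intro mono[OF sets refl] Y(2)) (auto simp: P_def)
    show "emeasure M X \<le> emeasure N X" if "X \<in> sets M" "X \<subseteq> Q" for X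
      using that by (intro mono[OF refl sets] Y(3)) (auto simp: Q_def)
  qed
qed

section \<open>Test functions that are continuous and bounded\<close>

lemma sum_measure_exists:
  assumes sets: "sets N = sets M"
  obtains S where "sets S = sets M" "\<And>X. X \<in> sets M \<Longrightarrow> emeasure S X = emeasure M X + emeasure N X"
proof
  let ?m = "\<lambda>X. emeasure M X + emeasure N X"
  let ?S = "measure_of (space M) (sets M) ?m"
  show s: "sets ?S = sets M" by simp
  show "emeasure ?S X = ?m X" if "X \<in> sets M" for X
  proof (rule emeasure_measure_of[OF refl])
    show "sets M \<subseteq> Pow (space M)" by (rule sets.space_closed)
    show "positive (sets ?S) ?m" by (simp add: positive_def)
    show "countably_additive (sets ?S) ?m"
      unfolding s by (intro countably_additiveI)
        (simp add: suminf_add[OF summableI summableI, symmetric] suminf_emeasure sets)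
    show "X \<in> sets ?S" using that by simp
  qed
qed

text \<open>
  Inner regularity gives compact \<open>K \<subseteq> A\<close> and \<open>L \<subseteq> - A\<close> that together carry almost all mass, and
  Urysohn's lemma gives a continuous function that is \<open>1\<close> on \<open>K\<close> and \<open>0\<close> on \<open>L\<close>. One function has to
  serve both measures, so regularity is applied to their sum.
\<close>

lemma continuous_approximation_indicator:
  fixes M N :: "real measure"
  assumes M: "finite_measure M" "sets M = sets borel" and N: "finite_measure N" "sets N = sets borel"
    and A: "A \<in> sets borel" and e: "0 < e"
  obtains g where "continuous_on UNIV g" "\<And>x. 0 \<le> g x" "\<And>x. g x \<le> 1"
    "\<bar>(LINT x|M. g x) - measure M A\<bar> \<le> e" "\<bar>(LINT x|N. g x) - measure N A\<bar> \<le> e"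
proof -
  interpret M: finite_measure M by fact
  interpret N: finite_measure N by fact
  obtain S where S: "sets S = sets borel" "\<And>X. X \<in> sets borel \<Longrightarrow> emeasure S X = emeasure M X + emeasure N X"
    using sum_measure_exists[of N M] M(2) N(2) by metis
  have spS: "space S = UNIV" using sets_eq_imp_space_eq[OF S(1)] by simp
  interpret S: finite_measure S
    by (rule finite_measureI) (simp add: S(2) spS)
  have comp: "\<exists>K. compact K \<and> K \<subseteq> B \<and> measure S (B - K) < e / 2" if B: "B \<in> sets borel" for B
  proof -
    have "emeasure S B = (SUP K \<in> {K. K \<subseteq> B \<and> compact K}. emeasure S K)"
      by (rule inner_regular) (use S B in auto)
    moreover have "ennreal (measure S B - e / 2) < emeasure S B \<or> measure S B = 0"
      using e zero_less_measure_iff[of S B] by (auto simp: S.emeasure_eq_measure intro!: ennreal_lessI)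
    ultimately consider "measure S B = 0" | K where "K \<subseteq> B" "compact K" "ennreal (measure S B - e / 2) < emeasure S K"
      by (auto simp: less_SUP_iff)
    then show ?thesis
    proof cases
      case 1 then show ?thesis using e by (intro exI[of _ "{}"]) auto
    next
      case 2
      have [simp]: "K \<in> sets S" using 2(2) S(1) by (simp add: borel_compact)
      have "measure S B - e / 2 < measure S K"
        using 2(3) by (cases "0 \<le> measure S B - e / 2")
          (auto simp: S.emeasure_eq_measure ennreal_less_iff intro: less_le_trans[of _ 0])
      then have "measure S (B - K) < e / 2"
        using 2 B S(1) by (subst S.finite_measure_Diff) auto
      then show ?thesis using 2 by blast
    qed
  qed
  obtain K where K: "compact K" "K \<subseteq> A" "measure S (A - K) < e / 2" using comp[OF A] by auto
  obtain L where L: "compact L" "L \<subseteq> - A" "measure S (- A - L) < e / 2" using comp[of "- A"] A by auto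
  have "K \<inter> L = {}" using K L by blast
  then obtain g where g: "continuous_on UNIV g" "\<And>x. g x \<in> closed_segment (1::real) 0"
      "\<And>x. x \<in> K \<Longrightarrow> g x = 1" "\<And>x. x \<in> L \<Longrightarrow> g x = 0"
    using Urysohn[of K L 1 0] compact_imp_closed K(1) L(1) by metis
  have g01: "0 \<le> g x" "g x \<le> 1" for x using g(2)[of x] by (auto simp: closed_segment_eq_real_ivl)
  have [measurable]: "g \<in> borel_measurable borel" using g(1) by (rule borel_measurable_continuous_onI)
  have KL[measurable]: "K \<in> sets borel" "L \<in> sets borel" using K(1) L(1) by (auto simp: borel_compact)
  define E where "E = (A - K) \<union> (- A - L)"
  have E: "E \<in> sets borel" unfolding E_def using A by measurable
  have "measure S E \<le> measure S (A - K) + measure S (- A - L)"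
    unfolding E_def using A KL S(1) by (intro measure_Un_le) auto
  then have SE: "measure S E \<le> e" using K(3) L(3) by simp
  have le: "\<bar>(LINT x|X. g x) - measure X A\<bar> \<le> e"
    if X: "finite_measure X" "sets X = sets borel" and XS: "emeasure X E \<le> emeasure S E" for X
  proof -
    interpret X: finite_measure X by fact
    note [measurable_cong] = X(2)
    note [measurable] = A E
    have sp: "space X = UNIV" using sets_eq_imp_space_eq[OF X(2)] by simp
    have gi: "integrable X g"
      by (rule X.integrable_const_bound[of _ 1]) (use g01 in auto)
    have ii: "integrable X (indicator B :: real \<Rightarrow> real)" if "B \<in> sets borel" for B
      using that X(2) by (auto simp: X.emeasure_eq_measure)
    have "(LINT x|X. g x) - measure X A = (LINT x|X. g x - indicator A x)"
      using A X(2) by (subst Bochner_Integration.integral_diff[OF gi ii]) (auto simp: sp)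
    also have "\<bar>\<dots>\<bar> \<le> (LINT x|X. indicator E x)"
    proof (rule integral_abs_bound_integral[OF _ ii])
      show "integrable X (\<lambda>x. g x - indicator A x)" by (intro Bochner_Integration.integrable_diff gi ii) fact
      show "\<bar>g x - indicator A x\<bar> \<le> indicator E x" for x
        using g01[of x] g(3,4)[of x] by (auto simp: E_def split: split_indicator)
    qed fact
    also have "\<dots> = measure X E" by (simp add: sp)
    also have "\<dots> \<le> measure S E"
      using XS by (simp add: X.emeasure_eq_measure S.emeasure_eq_measure)
    finally show ?thesis using SE by simp
  qed
  show thesis
    by (rule that[OF g(1) g01 le le]) (use M N S E in auto)
qed

text \<open>
  \<open>\<integral>w d\<bar>M - N\<bar>\<close> is the supremum of \<open>\<integral>f dM - \<integral>f dN\<close> over continuous bounded \<open>f\<close> with \<open>\<bar>f\<bar> \<le> w\<close>; these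
  test functions are the ones on which weak convergence can be used. The truncations \<open>min w i\<close> make
  \<open>w g\<close> bounded for continuous \<open>g\<close> with \<open>\<bar>g\<bar> \<le> 1\<close>, and such \<open>g\<close> approximate the sign function of a Hahn
  decomposition with respect to the finite measures \<open>w M\<close> and \<open>w N\<close>.
\<close>

lemma nn_integral_tv_le_dual:
  fixes w :: "real \<Rightarrow> real"
  assumes M: "sets M = sets borel" and N: "finite_measure N" "sets N = sets borel"
    and int: "integrable M w" "integrable N w" and w: "\<And>x. 0 \<le> w x" "continuous_on UNIV w"
    and dual: "\<And>f. continuous_on UNIV f \<Longrightarrow> bounded (range f) \<Longrightarrow> (\<And>x. \<bar>f x\<bar> \<le> w x) \<Longrightarrow>
      (LINT x|M. f x) - (LINT x|N. f x) \<le> c"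
  shows "(\<integral>\<^sup>+x. ennreal (w x) \<partial>tv_measure M N) \<le> ennreal c"
proof -
  note [measurable_cong] = M N(2)
  have [measurable]: "w \<in> borel_measurable borel" using w(2) by (rule borel_measurable_continuous_onI)
  have D: "(LINT x|M. w x * g x) - (LINT x|N. w x * g x) \<le> c"
    if g: "continuous_on UNIV g" "\<And>x. \<bar>g x\<bar> \<le> 1" for g
  proof -
    have [measurable]: "g \<in> borel_measurable borel" using g(1) by (rule borel_measurable_continuous_onI)
    let ?f = "\<lambda>i x. min (w x) (real i) * g x"
    have b: "\<bar>?f i x\<bar> \<le> w x" "\<bar>?f i x\<bar> \<le> real i" for i x
    proof -
      have "\<bar>?f i x\<bar> \<le> min (w x) (real i) * 1"
        using w(1)[of x] g(2)[of x] by (simp only: abs_mult) (intro mult_mono, auto)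
      then show "\<bar>?f i x\<bar> \<le> w x" "\<bar>?f i x\<bar> \<le> real i" by auto
    qed
    have lim: "(\<lambda>i. ?f i x) \<longlonglongrightarrow> w x * g x" for x
    proof -
      obtain j where "w x \<le> real j" using real_arch_simple by blast
      then have "eventually (\<lambda>i. ?f i x = w x * g x) sequentially"
        by (intro eventually_sequentiallyI[of j]) (simp add: min_def)
      then show ?thesis by (rule tendsto_eventually)
    qed
    have conv: "(\<lambda>i. LINT x|X. ?f i x) \<longlonglongrightarrow> (LINT x|X. w x * g x)"
      if "integrable X w" and [measurable_cong]: "sets X = sets borel" for X
      by (rule integral_dominated_convergence[where w=w]) (use that lim b in auto)
    have "(LINT x|M. ?f i x) - (LINT x|N. ?f i x) \<le> c" for i
      by (rule dual) (auto intro!: continuous_intros w g b(1) boundedI[where B="real i"] simp: b(2))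
    then show ?thesis
      by (intro LIMSEQ_le_const2[OF tendsto_diff[OF conv[OF int(1) M] conv[OF int(2) N(2)]]]) auto
  qed
  have NM: "sets N = sets M" by (simp add: M N)
  obtain P Q where PQ: "P \<in> sets M" "Q \<in> sets M" "P \<inter> Q = {}" "P \<union> Q = {x \<in> space M. w x \<noteq> 0}"
    "\<forall>X\<in>sets M. X \<subseteq> P \<longrightarrow> emeasure N X \<le> emeasure M X"
    "\<forall>X\<in>sets M. X \<subseteq> Q \<longrightarrow> emeasure M X \<le> emeasure N X"
    using weighted_Hahn_decomposition[OF NM int w(1)] by (elim bexE conjE) (rule that; assumption)
  have spM: "space M = UNIV" using sets_eq_imp_space_eq[OF M] by simp
  have P[measurable]: "P \<in> sets borel" using PQ(1) M by simp
  let ?D = "\<lambda>X. density X (\<lambda>x. ennreal (w x))"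
  have fin: "finite_measure (?D X)" if "integrable X w" for X
    using that w(1) by (auto intro!: finite_measureI simp: emeasure_density nn_integral_eq_integral
      cong: nn_integral_cong_simp)
  have wsplit: "w x * (indicator P x - indicator Q x) = 2 * (w x * indicator P x) - w x" for x
    using PQ(3,4) spM by (auto split: split_indicator)
  \<comment> \<open>Both integrals are affine in integrals against \<open>w X\<close>, so that \<open>2 g - 1\<close> with \<open>g\<close> close to \<open>1\<^sub>P\<close>
    replaces the sign function.\<close>
  have Pint: "(LINT x|X. w x * (indicator P x - indicator Q x)) = 2 * measure (?D X) P - (LINT x|X. w x)"
    if X: "integrable X w" and [measurable_cong]: "sets X = sets borel" for X
  proof -
    have [simp]: "space X = UNIV" using sets_eq_imp_space_eq[OF that(2)] by simp
    have i: "integrable X (\<lambda>x. w x * indicator P x)"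
      using X by (intro integrable_real_mult_indicator) auto
    have "measure (?D X) P = (LINT x|?D X. indicator P x)" by simp
    also have "\<dots> = (LINT x|X. w x * indicator P x)"
      by (subst integral_density) (use w in auto)
    finally show ?thesis
      using i X by (simp add: wsplit)
  qed
  have gint: "(LINT x|X. w x * (2 * g x - 1)) = 2 * (LINT x|?D X. g x) - (LINT x|X. w x)"
    if X: "integrable X w" and [measurable_cong]: "sets X = sets borel"
      and g: "continuous_on UNIV g" "\<And>x. 0 \<le> g x" "\<And>x. g x \<le> 1" for X g
  proof -
    have [measurable]: "g \<in> borel_measurable borel" using g(1) by (rule borel_measurable_continuous_onI)
    have i: "integrable X (\<lambda>x. w x * g x)"
      by (rule Bochner_Integration.integrable_bound[OF X]) (use g w in \<open>auto simp: abs_mult intro!: mult_left_le\<close>)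
    have "(LINT x|?D X. g x) = (LINT x|X. w x * g x)"
      by (subst integral_density) (use w in auto)
    moreover have "(\<lambda>x. w x * (2 * g x - 1)) = (\<lambda>x. 2 * (w x * g x) - w x)" by (auto simp: algebra_simps)
    ultimately show ?thesis using i X by simp
  qed
  let ?s = "\<lambda>x. w x * (indicator P x - indicator Q x)"
  have "(LINT x|M. ?s x) - (LINT x|N. ?s x) \<le> c + e" if "0 < e" for e
  proof -
    obtain g where g: "continuous_on UNIV g" "\<And>x. 0 \<le> g x" "\<And>x. g x \<le> 1"
      "\<bar>(LINT x|?D M. g x) - measure (?D M) P\<bar> \<le> e / 4" "\<bar>(LINT x|?D N. g x) - measure (?D N) P\<bar> \<le> e / 4"
      using continuous_approximation_indicator[of "?D M" "?D N" P "e / 4"] fin int M N(2) P \<open>0 < e\<close> by auto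
    have "(LINT x|M. w x * (2 * g x - 1)) - (LINT x|N. w x * (2 * g x - 1)) \<le> c"
      by (rule D) (use g(1-3) in \<open>auto intro!: continuous_intros simp: abs_le_iff\<close>)
    then show ?thesis
      using g(4,5) unfolding gint[OF int(1) M g(1-3)] gint[OF int(2) N(2) g(1-3)]
        Pint[OF int(1) M] Pint[OF int(2) N(2)] by linarith
  qed
  then have "(LINT x|M. ?s x) - (LINT x|N. ?s x) \<le> c" by (rule field_le_epsilon)
  moreover have "(\<integral>\<^sup>+x. ennreal (w x) \<partial>tv_measure M N) \<le> ennreal ((LINT x|M. ?s x) - (LINT x|N. ?s x))"
    using PQ N M int w by (intro nn_integral_tv_Hahn) (auto simp: spM)
  ultimately show ?thesis by (meson ennreal_leI order_trans)
qed

section \<open>Weak convergence of finite measures on the line\<close>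

definition weakly_converges :: "(nat \<Rightarrow> real measure) \<Rightarrow> real measure \<Rightarrow> bool" where
  "weakly_converges \<mu> \<mu>' \<longleftrightarrow> (\<forall>f :: real \<Rightarrow> real. continuous_on UNIV f \<longrightarrow> bounded (range f) \<longrightarrow>
     (\<lambda>i. LINT x|\<mu> i. f x) \<longlonglongrightarrow> (LINT x|\<mu>'. f x))"

text \<open>
  Helly's selection theorem for the probability measures \<open>\<mu> i / \<Lambda>\<close>, scaled back. For \<open>\<Lambda> = 0\<close> there is
  no scaling, but then all measures are zero.
\<close>

lemma finite_measures_weakly_compact:
  fixes \<mu> :: "nat \<Rightarrow> real measure"
  assumes \<mu>: "\<And>i. \<mu> i \<in> finite_measures" and mass: "\<And>i. measure (\<mu> i) UNIV = \<Lambda>"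
    and tight: "\<And>e. 0 < e \<Longrightarrow> \<exists>a b. a < b \<and> (\<forall>i. measure (\<mu> i) (- {a<..b}) < e)"
  obtains r \<mu>' where "strict_mono (r :: nat \<Rightarrow> nat)" "\<mu>' \<in> finite_measures" "measure \<mu>' UNIV = \<Lambda>"
    "weakly_converges (\<mu> \<circ> r) \<mu>'"
proof -
  have fin: "finite_measure (\<mu> i)" and s[simp, measurable_cong]: "sets (\<mu> i) = sets borel" for i
    using \<mu> by (auto simp: finite_measures_def)
  have [simp]: "space (\<mu> i) = UNIV" for i using sets_eq_imp_space_eq[OF s] by simp
  have em: "emeasure (\<mu> i) X = ennreal (measure (\<mu> i) X)" for i X
    by (simp add: finite_measure.emeasure_eq_measure fin)
  show thesis
  proof (cases "\<Lambda> = 0")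
    case True
    have null: "\<mu> i = null_measure borel" for i
    proof (rule measure_eqI)
      fix X assume "X \<in> sets (\<mu> i)"
      have "measure (\<mu> i) X \<le> measure (\<mu> i) UNIV"
        using \<open>X \<in> _\<close> by (intro finite_measure.finite_measure_mono fin) auto
      then show "emeasure (\<mu> i) X = emeasure (null_measure borel) X"
        using True mass by (simp add: em measure_le_0_iff)
    qed simp
    show thesis
      by (rule that[of "\<lambda>i. i" "\<mu> 0"]) (use \<mu> mass null in \<open>auto simp: weakly_converges_def strict_mono_def\<close>)
  next
    case False
    have pos: "0 < \<Lambda>" using mass[of 0] False by (metis measure_nonneg less_le)
    define p where "p i = density (\<mu> i) (\<lambda>_. ennreal (1 / \<Lambda>))" for i
    have ep: "emeasure (p i) X = ennreal (measure (\<mu> i) X / \<Lambda>)" if "X \<in> sets borel" for i X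
      using that pos by (simp add: p_def emeasure_density_const em ennreal_mult'[symmetric])
    have mp: "measure (p i) X = measure (\<mu> i) X / \<Lambda>" if "X \<in> sets borel" for i X
      using pos by (intro measure_eq_emeasure_eq_ennreal ep that) simp
    have rd: "real_distribution (p i)" for i
      unfolding real_distribution_def real_distribution_axioms_def
      using mass pos by (auto intro!: prob_spaceI simp: p_def emeasure_density_const em ennreal_mult'[symmetric])
    then have pp: "prob_space (p i)" for i by (simp add: real_distribution_def)
    have "tight p"
      unfolding tight_def
    proof (intro conjI allI impI rd)
      fix e :: real assume e: "0 < e"
      then obtain a b where ab: "a < b" "\<And>i. measure (\<mu> i) (- {a<..b}) < e * \<Lambda>"
        using tight[of "e * \<Lambda>"] pos by auto
      have "1 - e < measure (p i) {a<..b}" for i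
      proof -
        have "measure (p i) (- {a<..b}) = 1 - measure (p i) {a<..b}"
          using prob_space.prob_compl[OF pp[of i], of "{a<..b}"] by (simp add: p_def Compl_eq_Diff_UNIV)
        moreover have "measure (p i) (- {a<..b}) < e"
          using ab(2)[of i] pos by (simp add: mp pos_divide_less_eq)
        ultimately show ?thesis by simp
      qed
      with ab(1) show "\<exists>a b. a < b \<and> (\<forall>n. 1 - e < measure (p n) {a<..b})" by blast
    qed
    then obtain r P where r: "strict_mono (r :: nat \<Rightarrow> nat)" and P: "real_distribution P"
        and conv: "weak_conv_m (p \<circ> id \<circ> r) P"
      using tight_imp_convergent_subsubsequence[of p id] strict_mono_id by blast
    interpret P: real_distribution P by fact
    define \<mu>' where "\<mu>' = density P (\<lambda>_. ennreal \<Lambda>)"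
    have s'[simp, measurable_cong]: "sets \<mu>' = sets borel" by (simp add: \<mu>'_def)
    have e': "emeasure \<mu>' UNIV = ennreal \<Lambda>"
      using P.emeasure_space_1 by (simp add: \<mu>'_def emeasure_density_const)
    have f': "finite_measure \<mu>'" using e' by (intro finite_measureI) (simp add: \<mu>'_def)
    have "(\<lambda>i. LINT x|\<mu> (r i). f x) \<longlonglongrightarrow> (LINT x|\<mu>'. f x)"
      if f: "continuous_on UNIV f" "bounded (range f)" for f :: "real \<Rightarrow> real"
    proof -
      have [measurable]: "f \<in> borel_measurable borel" using f(1) by (rule borel_measurable_continuous_onI)
      obtain B where B: "\<And>x. norm (f x) \<le> B" using f(2) by (auto simp: bounded_iff)
      have "(\<lambda>i. integral\<^sup>L ((p \<circ> id \<circ> r) i) f) \<longlonglongrightarrow> integral\<^sup>L P f"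
        by (rule weak_conv_imp_integral_bdd_continuous_conv[OF _ P conv, where B=B])
          (use rd f(1) B in \<open>auto simp: continuous_on_eq_continuous_at\<close>)
      moreover have "integral\<^sup>L (p j) f = integral\<^sup>L (\<mu> j) f / \<Lambda>" for j
        unfolding p_def using pos by (subst integral_density) auto
      moreover have "integral\<^sup>L \<mu>' f = \<Lambda> * integral\<^sup>L P f"
        unfolding \<mu>'_def using pos by (subst integral_density) auto
      ultimately show ?thesis
        using pos tendsto_mult_left[of "\<lambda>i. integral\<^sup>L (\<mu> (r i)) f / \<Lambda>" "integral\<^sup>L P f" sequentially \<Lambda>] by simp
    qed
    then have "weakly_converges (\<mu> \<circ> r) \<mu>'" by (simp add: weakly_converges_def)
    with r f' e' show thesis
      using pos by (intro that[of r \<mu>']) (auto simp: finite_measures_def measure_def)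
  qed
qed

text \<open>
  Fatou's lemma for weak convergence: \<open>w\<close> is the increasing limit of the bounded continuous functions
  \<open>min w j\<close>, whose integrals converge.
\<close>

lemma weak_limit_nn_integral_le:
  fixes w :: "real \<Rightarrow> real"
  assumes conv: "weakly_converges \<mu> \<mu>'" and \<mu>: "\<And>i. \<mu> i \<in> finite_measures" and \<mu>': "\<mu>' \<in> finite_measures"
    and w: "continuous_on UNIV w" "\<And>x. 0 \<le> w x"
    and K: "\<And>i. (\<integral>\<^sup>+x. ennreal (w x) \<partial>\<mu> i) \<le> ennreal K"  "0 \<le> K"
  shows "(\<integral>\<^sup>+x. ennreal (w x) \<partial>\<mu>') \<le> ennreal K"
proof -
  have [measurable]: "w \<in> borel_measurable borel" using w(1) by (rule borel_measurable_continuous_onI)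
  have cont: "continuous_on UNIV (\<lambda>x. min (w x) (real j))" for j by (intro continuous_intros w)
  have bdd: "bounded (range (\<lambda>x. min (w x) (real j)))" for j
    using w(2) by (auto intro!: boundedI[where B="real j"] simp: abs_le_iff le_max_iff_disj min_le_iff_disj intro: order_trans[of _ 0])
  have int: "integrable X (\<lambda>x. min (w x) (real j))" if "X \<in> finite_measures" for X j
  proof -
    interpret finite_measure X using that by (simp add: finite_measures_def)
    have [measurable_cong]: "sets X = sets borel" using that by (simp add: finite_measures_def)
    show ?thesis by (rule integrable_const_bound[of _ "real j"]) (use w(2) in auto)
  qed
  have nn: "(\<integral>\<^sup>+x. ennreal (min (w x) (real j)) \<partial>X) = ennreal (LINT x|X. min (w x) (real j))"
    if "X \<in> finite_measures" for X j
    by (intro nn_integral_eq_integral int that) (simp add: w)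
  have "(LINT x|\<mu> i. min (w x) (real j)) \<le> K" for i j
  proof -
    have "ennreal (LINT x|\<mu> i. min (w x) (real j)) \<le> (\<integral>\<^sup>+x. ennreal (w x) \<partial>\<mu> i)"
      unfolding nn[OF \<mu>, symmetric] by (intro nn_integral_mono ennreal_leI) simp
    then show ?thesis using K(1)[of i] K(2) by (meson ennreal_le_iff order_trans)
  qed
  moreover have "(\<lambda>i. LINT x|\<mu> i. min (w x) (real j)) \<longlonglongrightarrow> (LINT x|\<mu>'. min (w x) (real j))" for j
    using conv cont bdd by (simp add: weakly_converges_def)
  ultimately have le: "(LINT x|\<mu>'. min (w x) (real j)) \<le> K" for j
    by (intro LIMSEQ_le_const2[where X="\<lambda>i. LINT x|\<mu> i. min (w x) (real j)"]) simp_all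
  have s[measurable_cong]: "sets \<mu>' = sets borel" using \<mu>' by (simp add: finite_measures_def)
  have "(SUP j. ennreal (min (w x) (real j))) = ennreal (w x)" for x
  proof (rule antisym)
    obtain j where "w x \<le> real j" using real_arch_simple by blast
    then show "ennreal (w x) \<le> (SUP j. ennreal (min (w x) (real j)))"
      by (intro SUP_upper2[of j]) auto
  qed (auto intro!: SUP_least ennreal_leI)
  then have "(\<integral>\<^sup>+x. ennreal (w x) \<partial>\<mu>') = (\<integral>\<^sup>+x. (SUP j. ennreal (min (w x) (real j))) \<partial>\<mu>')" by simp
  also have "\<dots> = (SUP j. \<integral>\<^sup>+x. ennreal (min (w x) (real j)) \<partial>\<mu>')"
    by (intro nn_integral_monotone_convergence_SUP) (auto simp: incseq_def le_fun_def intro!: ennreal_leI)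
  also have "\<dots> \<le> ennreal K"
    unfolding nn[OF \<mu>'] by (intro SUP_least ennreal_leI le)
  finally show ?thesis .
qed

text \<open>
  Weak convergence only handles bounded functions. If \<open>h\<close> is negligible against \<open>w\<close> where it is
  large, clipping \<open>h\<close> to \<open>[- B, B]\<close> changes its integrals by at most \<open>e K\<close>, uniformly in \<open>i\<close>, and the
  clipped function is bounded. For \<open>h = w\<close> the convergence can fail: mass may escape to infinity.
\<close>

lemma weak_limit_integral_dominated:
  fixes w h :: "real \<Rightarrow> real"
  assumes conv: "weakly_converges \<mu> \<mu>'" and \<mu>: "\<And>i. \<mu> i \<in> finite_measures" and \<mu>': "\<mu>' \<in> finite_measures"
    and w: "continuous_on UNIV w" "\<And>x. 0 \<le> w x" and h: "continuous_on UNIV h"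
    and K: "\<And>i. (\<integral>\<^sup>+x. ennreal (w x) \<partial>\<mu> i) \<le> ennreal K" "0 \<le> K"
    and small: "\<And>e. 0 < e \<Longrightarrow> \<exists>B. \<forall>x. \<bar>h x\<bar> \<le> B \<or> \<bar>h x\<bar> \<le> e * w x"
  shows "integrable \<mu>' h" and "(\<lambda>i. LINT x|\<mu> i. h x) \<longlonglongrightarrow> (LINT x|\<mu>'. h x)"
proof -
  have [measurable]: "w \<in> borel_measurable borel" "h \<in> borel_measurable borel"
    using w(1) h by (auto intro: borel_measurable_continuous_onI)
  have K': "(\<integral>\<^sup>+x. ennreal (w x) \<partial>\<mu>') \<le> ennreal K"
    using weak_limit_nn_integral_le[OF conv \<mu> \<mu>' w K] .
  have wint: "integrable X w" "(LINT x|X. w x) \<le> K"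
    if X: "X \<in> finite_measures" and le: "(\<integral>\<^sup>+x. ennreal (w x) \<partial>X) \<le> ennreal K" for X
  proof -
    have [measurable_cong]: "sets X = sets borel" using X by (simp add: finite_measures_def)
    show i: "integrable X w"
      using le w(2) by (intro integrableI_nonneg) (auto simp: less_top[symmetric] top_unique)
    then show "(LINT x|X. w x) \<le> K"
      using le K(2) by (simp add: nn_integral_eq_integral w)
  qed
  have approx: "integrable X h" "\<bar>(LINT x|X. h x) - (LINT x|X. max (- B) (min B (h x)))\<bar> \<le> e * K"
    if X: "X \<in> finite_measures" and le: "(\<integral>\<^sup>+x. ennreal (w x) \<partial>X) \<le> ennreal K"
      and B: "\<And>x. \<bar>h x\<bar> \<le> B \<or> \<bar>h x\<bar> \<le> e * w x" "0 \<le> B" and e: "0 < e" for X B e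
  proof -
    interpret X: finite_measure X using X by (simp add: finite_measures_def)
    have [measurable_cong]: "sets X = sets borel" using X by (simp add: finite_measures_def)
    have "\<bar>h x\<bar> \<le> B + e * w x" for x
      using B(1)[of x] B(2) e w(2)[of x] by (auto intro: add_increasing add_increasing2)
    then show i: "integrable X h"
      using wint(1)[OF X le] B(2) e w(2)
      by (intro Bochner_Integration.integrable_bound[of X "\<lambda>x. B + e * w x" h]) auto
    have t: "integrable X (\<lambda>x. max (- B) (min B (h x)))"
      by (rule X.integrable_const_bound[of _ B]) (use B(2) in auto)
    have "\<bar>LINT x|X. h x - max (- B) (min B (h x))\<bar> \<le> (LINT x|X. e * w x)"
    proof (rule integral_abs_bound_integral)
      show "\<bar>h x - max (- B) (min B (h x))\<bar> \<le> e * w x" for x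
      proof -
        have "0 \<le> e * w x" using e w(2) by simp
        then show ?thesis using B(1)[of x] B(2) by (auto simp: max_def min_def abs_if)
      qed
    qed (use i t wint(1)[OF X le] in auto)
    also have "\<dots> \<le> e * K" using wint[OF X le] e by simp
    finally show "\<bar>(LINT x|X. h x) - (LINT x|X. max (- B) (min B (h x)))\<bar> \<le> e * K"
      using i t by simp
  qed
  have smallB: "\<exists>B\<ge>0. \<forall>x. \<bar>h x\<bar> \<le> B \<or> \<bar>h x\<bar> \<le> e * w x" if e: "0 < e" for e
  proof -
    obtain B where "\<forall>x. \<bar>h x\<bar> \<le> B \<or> \<bar>h x\<bar> \<le> e * w x" using small[OF e] by blast
    then show ?thesis by (intro exI[of _ "max 0 B"]) (auto simp: le_max_iff_disj)
  qed
  show "integrable \<mu>' h"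
    using smallB[of 1] approx(1)[OF \<mu>' K', of _ 1] by auto
  show "(\<lambda>i. LINT x|\<mu> i. h x) \<longlonglongrightarrow> (LINT x|\<mu>'. h x)"
  proof (rule LIMSEQ_I)
    fix d :: real assume d: "0 < d"
    define e where "e = d / (4 * (K + 1))"
    have e: "0 < e" and eK: "e * K \<le> d / 4" using d K(2) by (auto simp: e_def field_simps)
    obtain B where B: "0 \<le> B" "\<And>x. \<bar>h x\<bar> \<le> B \<or> \<bar>h x\<bar> \<le> e * w x" using smallB[OF e] by auto
    let ?t = "\<lambda>x. max (- B) (min B (h x))"
    have "continuous_on UNIV ?t" by (intro continuous_intros h)
    moreover have "bounded (range ?t)" using B(1) by (auto intro!: boundedI[where B=B])
    ultimately have "(\<lambda>i. LINT x|\<mu> i. ?t x) \<longlonglongrightarrow> (LINT x|\<mu>'. ?t x)"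
      using conv by (simp add: weakly_converges_def)
    then obtain i0 where i0: "\<And>i. i0 \<le> i \<Longrightarrow> \<bar>(LINT x|\<mu> i. ?t x) - (LINT x|\<mu>'. ?t x)\<bar> < d / 4"
      using LIMSEQ_D[of _ _ "d / 4"] d by fastforce
    have "\<bar>(LINT x|\<mu> i. h x) - (LINT x|\<mu>'. h x)\<bar> < d" if "i0 \<le> i" for i
      using i0[OF that] approx(2)[OF \<mu> K(1) B(2,1) e, of i] approx(2)[OF \<mu>' K' B(2,1) e] eK d by linarith
    then show "\<exists>no. \<forall>i\<ge>no. norm ((LINT x|\<mu> i. h x) - (LINT x|\<mu>'. h x)) < d"
      by auto
  qed
qed

section \<open>Feasibility and moment bounds\<close>

text \<open>
  The powers \<open>y ^ k\<close> with \<open>k \<ge> 2\<close> vanish at \<open>0\<close>, so an atom at \<open>0\<close> supplies missing mass without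
  touching the moments.
\<close>

lemma has_moments_add_mass_at_0:
  assumes \<mu>: "\<mu> \<in> finite_measures" "measure \<mu> UNIV \<le> \<Lambda>"
  obtains \<rho> where "\<rho> \<in> finite_measures" "measure \<rho> UNIV = \<Lambda>"
    "\<And>m n. has_moments m n \<mu> \<Longrightarrow> has_moments m n \<rho>"
proof -
  interpret finite_measure \<mu> using \<mu> by (simp add: finite_measures_def)
  have s\<mu>[measurable_cong]: "sets \<mu> = sets borel" using \<mu> by (simp add: finite_measures_def)
  define d where "d = \<Lambda> - measure \<mu> UNIV"
  have d: "0 \<le> d" using \<mu> by (simp add: d_def)
  let ?\<delta> = "density (return borel (0 :: real)) (\<lambda>_. ennreal d)"
  obtain \<rho> where s[measurable_cong]: "sets \<rho> = sets borel"
      and e: "\<And>X. X \<in> sets borel \<Longrightarrow> emeasure \<rho> X = emeasure \<mu> X + emeasure ?\<delta> X"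
    using sum_measure_exists[of ?\<delta> \<mu>] s\<mu> by auto
  have e\<delta>: "emeasure ?\<delta> X = ennreal d * indicator X 0" if "X \<in> sets borel" for X
    using that by (simp add: emeasure_density_const)
  have mass: "emeasure \<rho> UNIV = ennreal \<Lambda>"
    using d by (simp add: e e\<delta> emeasure_eq_measure flip: ennreal_plus) (simp add: d_def)
  have \<Lambda>: "0 \<le> \<Lambda>" using \<mu>(2) measure_nonneg[of \<mu> UNIV] by linarith
  have fin: "\<rho> \<in> finite_measures"
    using mass s by (auto simp: finite_measures_def sets_eq_imp_space_eq[OF s] intro!: finite_measureI)
  \<comment> \<open>\<open>\<rho>\<close> and \<open>\<mu>\<close> agree off \<open>0\<close>, hence on functions that vanish at \<open>0\<close>.\<close>
  have D: "density \<rho> (indicator (- {0})) = density \<mu> (indicator (- {0}))"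
  proof (rule measure_eqI)
    fix X assume "X \<in> sets (density \<rho> (indicator (- {0})))"
    then have X: "X \<in> sets borel" by (simp add: s)
    then have "emeasure \<rho> (- {0} \<inter> X) = emeasure \<mu> (- {0} \<inter> X)"
      by (subst e) (auto simp: e\<delta>)
    then show "emeasure (density \<rho> (indicator (- {0}))) X = emeasure (density \<mu> (indicator (- {0}))) X"
      using X by (simp add: emeasure_restricted s s\<mu>)
  qed (simp add: s s\<mu>)
  have *: "integrable X f = integrable (density X (indicator (- {0}))) f"
      "integral\<^sup>L X f = integral\<^sup>L (density X (indicator (- {0}))) f"
    if f: "f 0 = 0" and [measurable]: "f \<in> borel_measurable borel" and [measurable_cong]: "sets X = sets borel"
    for X and f :: "real \<Rightarrow> real"
  proof -
    have [simp]: "(\<lambda>x. indicator (- {0}) x * f x) = f" using f by (auto split: split_indicator)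
    show "integrable X f = integrable (density X (indicator (- {0}))) f"
      using integrable_real_density[of "indicator (- {0})" X f] by (simp add: ennreal_indicator)
    show "integral\<^sup>L X f = integral\<^sup>L (density X (indicator (- {0}))) f"
      using integral_real_density[of "indicator (- {0})" X f] by (simp add: ennreal_indicator)
  qed
  have "integrable \<rho> (\<lambda>y. y ^ k) = integrable \<mu> (\<lambda>y. y ^ k)" "(LINT y|\<rho>. y ^ k) = (LINT y|\<mu>. y ^ k)"
    if "2 \<le> k" for k
    using *[of "\<lambda>y. y ^ k" \<rho>] *[of "\<lambda>y. y ^ k" \<mu>] that by (simp_all add: s s\<mu> D)
  then have "has_moments m n \<rho>" if "has_moments m n \<mu>" for m n
    using that by (simp add: has_moments_def)
  with fin mass \<Lambda> show thesis by (intro that[of \<rho>]) (auto simp: measure_def)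
qed

lemma admissible_nonempty:
  assumes "n \<ge> 2" and "n = 2 \<Longrightarrow> 0 \<le> \<Lambda>"
    and "n \<ge> 3 \<Longrightarrow> \<exists>\<mu> \<in> moment_class m (n - 1). measure \<mu> UNIV \<le> \<Lambda>"
  shows "admissible m n \<Lambda> \<noteq> {}"
proof -
  have "\<exists>\<mu> \<in> moment_class m (n - 1). measure \<mu> UNIV \<le> \<Lambda>"
  proof (cases "n = 2")
    case True
    have "null_measure borel \<in> moment_class m (n - 1)"
      using True by (auto simp: moment_class_def finite_measures_def has_moments_def intro!: finite_measureI)
    then show ?thesis using True assms(2) by (intro bexI[of _ "null_measure borel"]) auto
  qed (use assms in auto)
  then obtain \<mu> where \<mu>: "\<mu> \<in> finite_measures" "has_moments m (n - 1) \<mu>" "measure \<mu> UNIV \<le> \<Lambda>"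
    by (auto simp: moment_class_def)
  obtain \<rho> where "\<rho> \<in> finite_measures" "measure \<rho> UNIV = \<Lambda>" "has_moments m (n - 1) \<rho>"
    using has_moments_add_mass_at_0[OF \<mu>(1,3)] \<mu>(2) by metis
  then show ?thesis by (auto simp: admissible_def)
qed

text \<open>
  This is where it matters that only moments of order less than \<open>n\<close> are prescribed.
\<close>

lemma power_little_o:
  assumes "k < n" "0 < e"
  shows "\<exists>B. \<forall>y :: real. \<bar>y ^ k\<bar> \<le> B \<or> \<bar>y ^ k\<bar> \<le> e * \<bar>y\<bar> ^ n"
proof (intro exI allI)
  fix y :: real
  \<comment> \<open>Beyond \<open>R\<close> one extra factor \<open>\<bar>y\<bar>\<close> outweighs \<open>1 / e\<close>, and any further factor is at least \<open>1\<close>.\<close>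
  define R where "R = max 1 (1 / e)"
  have R: "1 \<le> R" "1 \<le> e * R" using assms(2) by (auto simp: R_def max_def field_simps)
  show "\<bar>y ^ k\<bar> \<le> R ^ k \<or> \<bar>y ^ k\<bar> \<le> e * \<bar>y\<bar> ^ n"
  proof (cases "\<bar>y\<bar> \<le> R")
    case True
    then show ?thesis by (simp add: power_abs power_mono)
  next
    case False
    have "\<bar>y\<bar> ^ k * 1 \<le> \<bar>y\<bar> ^ k * (e * \<bar>y\<bar>)"
      using False R assms(2) by (intro mult_left_mono order_trans[OF R(2)]) auto
    also have "\<dots> = e * \<bar>y\<bar> ^ Suc k" by simp
    also have "\<dots> \<le> e * \<bar>y\<bar> ^ n"
      using False R assms by (intro mult_left_mono power_increasing) auto
    finally show ?thesis by (simp add: power_abs)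
  qed
qed

text \<open>
  Markov's inequality for \<open>\<bar>y\<bar> ^ n\<close>.
\<close>

lemma moment_bound_imp_tight:
  assumes \<mu>: "\<And>i. \<mu> i \<in> finite_measures" and n: "1 \<le> n" and K: "0 \<le> K"
    "\<And>i. (\<integral>\<^sup>+y. ennreal (\<bar>y\<bar> ^ n) \<partial>\<mu> i) \<le> ennreal K" and e: "0 < (e :: real)"
  shows "\<exists>a b. a < b \<and> (\<forall>i. measure (\<mu> i) (- {a<..b}) < e)"
proof -
  define R where "R = K / e + 1"
  have R: "1 \<le> R" "K < R * e" using K e by (auto simp: R_def field_simps)
  have "measure (\<mu> i) (- {- R<..R}) < e" for i
  proof -
    interpret finite_measure "\<mu> i" using \<mu> by (simp add: finite_measures_def)
    have s[measurable_cong]: "sets (\<mu> i) = sets borel" using \<mu> by (simp add: finite_measures_def)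
    have "ennreal R * emeasure (\<mu> i) (- {- R<..R}) = (\<integral>\<^sup>+y. ennreal R * indicator (- {- R<..R}) y \<partial>\<mu> i)"
      by (simp add: nn_integral_cmult_indicator s)
    also have "\<dots> \<le> (\<integral>\<^sup>+y. ennreal (\<bar>y\<bar> ^ n) \<partial>\<mu> i)"
    proof (intro nn_integral_mono)
      fix y :: real
      show "ennreal R * indicator (- {- R<..R}) y \<le> ennreal (\<bar>y\<bar> ^ n)"
      proof (cases "y \<in> - {- R<..R}")
        case True
        then have "R \<le> \<bar>y\<bar>" by auto
        moreover have "\<bar>y\<bar> ^ 1 \<le> \<bar>y\<bar> ^ n" using \<open>R \<le> \<bar>y\<bar>\<close> R n by (intro power_increasing) auto
        ultimately show ?thesis using True by (simp add: ennreal_leI)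
      qed simp
    qed
    also have "\<dots> \<le> ennreal K" by (rule K)
    finally have "R * measure (\<mu> i) (- {- R<..R}) \<le> K"
      using R K by (simp add: emeasure_eq_measure flip: ennreal_mult')
    with R(2) have "R * measure (\<mu> i) (- {- R<..R}) < R * e" by (rule order_le_less_trans[rotated])
    then show ?thesis using R(1) by simp
  qed
  then show ?thesis using R by (intro exI[of _ "- R"] exI[of _ R]) auto
qed

section \<open>Existence of a minimizer\<close>

theorem proposition21:
  fixes n :: nat and \<nu> :: "real measure" and m :: "nat \<Rightarrow> real" and \<Lambda> :: real
  assumes "n \<ge> 2"
    and "levy_measure \<nu>"
    and "emeasure \<nu> UNIV = \<infinity>"
    and "(\<integral>\<^sup>+ y. ennreal (\<bar>y\<bar> ^ n) \<partial>\<nu>) < \<infinity>"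
    and "\<And>k. 2 \<le> k \<Longrightarrow> k \<le> n \<Longrightarrow> m k = (LINT y|\<nu>. y ^ k)"
    and "n = 2 \<Longrightarrow> 0 \<le> \<Lambda>"
    and "n \<ge> 3 \<Longrightarrow> \<exists>\<mu> \<in> moment_class m (n - 1). measure \<mu> UNIV \<le> \<Lambda>"
  shows "\<exists>\<mu>\<^sub>0 \<in> admissible m n \<Lambda>. \<forall>\<mu> \<in> admissible m n \<Lambda>. J n \<nu> \<mu>\<^sub>0 \<le> J n \<nu> \<mu>"
proof -
  let ?A = "admissible m n \<Lambda>" and ?w = "\<lambda>y :: real. \<bar>y\<bar> ^ n"
  note n = assms(1)
  have s\<nu>[measurable_cong]: "sets \<nu> = sets borel" using assms(2) by (simp add: levy_measure_def)
  have w: "continuous_on UNIV ?w" "\<And>y. 0 \<le> ?w y" by (auto intro!: continuous_intros)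
  have w\<nu>: "integrable \<nu> ?w"
    using assms(4) by (intro integrableI_nonneg) auto
  obtain \<mu>\<^sub>1 where \<mu>\<^sub>1: "\<mu>\<^sub>1 \<in> ?A" using admissible_nonempty[OF assms(1,6,7)] by blast
  define I where "I = (INF \<mu>\<in>?A. J n \<nu> \<mu>)"
  show ?thesis
  proof (cases "I = top")
    case True
    then show ?thesis using \<mu>\<^sub>1 by (auto simp: I_def INF_top_conv intro!: bexI[of _ \<mu>\<^sub>1])
  next
    case False
    then obtain c where c: "I = ennreal c" "0 \<le> c" by (cases I) auto
    have "\<exists>\<mu>\<in>?A. J n \<nu> \<mu> < ennreal (c + inverse (Suc i))" for i
    proof -
      have "I < ennreal (c + inverse (Suc i))" using c by (auto intro!: ennreal_lessI simp: add_nonneg_pos)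
      then show ?thesis by (simp add: I_def INF_less_iff)
    qed
    then obtain \<mu> where \<mu>: "\<And>i. \<mu> i \<in> ?A" and J\<mu>: "\<And>i. J n \<nu> (\<mu> i) < ennreal (c + inverse (Suc i))"
      by metis
    have fin: "\<mu> i \<in> finite_measures" and mass: "measure (\<mu> i) UNIV = \<Lambda>"
      and mom: "has_moments m (n - 1) (\<mu> i)" for i
      using \<mu>[of i] by (auto simp: admissible_def)
    have fm: "finite_measure (\<mu> i)" and s[measurable_cong]: "sets (\<mu> i) = sets borel" for i
      using fin[of i] by (auto simp: finite_measures_def)
    \<comment> \<open>Since \<open>\<mu> \<le> \<nu> + \<bar>\<nu> - \<mu>\<bar>\<close>, a bound on \<open>J\<close> bounds the moment of order \<open>n\<close>.\<close>
    define K where "K = (LINT y|\<nu>. ?w y) + (c + 1)"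
    have K0: "0 \<le> K" using c by (auto simp: K_def intro!: add_nonneg_nonneg integral_nonneg_AE)
    have K: "(\<integral>\<^sup>+y. ennreal (?w y) \<partial>\<mu> i) \<le> ennreal K" for i
    proof -
      have "(\<integral>\<^sup>+y. ennreal (?w y) \<partial>\<mu> i) \<le> (\<integral>\<^sup>+y. ennreal (?w y) \<partial>\<nu>) + J n \<nu> (\<mu> i)"
        unfolding J_def by (intro nn_integral_le_add_tv fm) (auto simp: s s\<nu>)
      also have "\<dots> \<le> ennreal (LINT y|\<nu>. ?w y) + ennreal (c + 1)"
        using order_less_imp_le[OF J\<mu>[of i]]
        by (intro add_mono) (auto simp: nn_integral_eq_integral[OF w\<nu>] elim!: order_trans intro!: ennreal_leI
            simp: inverse_eq_divide)
      also have "\<dots> = ennreal K" using c by (simp add: K_def integral_nonneg_AE flip: ennreal_plus)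
      finally show ?thesis .
    qed
    have w\<mu>: "integrable (\<mu> i) ?w" for i
      using K[of i] by (intro integrableI_nonneg) (auto simp: less_top[symmetric] top_unique)
    obtain r \<mu>\<^sub>0 where r: "strict_mono (r :: nat \<Rightarrow> nat)" and \<mu>\<^sub>0: "\<mu>\<^sub>0 \<in> finite_measures" "measure \<mu>\<^sub>0 UNIV = \<Lambda>"
      and conv: "weakly_converges (\<mu> \<circ> r) \<mu>\<^sub>0"
      using finite_measures_weakly_compact[of \<mu> \<Lambda>, OF fin mass]
        moment_bound_imp_tight[of \<mu> n K, OF fin _ K0 K] n by auto
    have fin': "(\<mu> \<circ> r) i \<in> finite_measures" and K': "(\<integral>\<^sup>+y. ennreal (?w y) \<partial>(\<mu> \<circ> r) i) \<le> ennreal K" for i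
      using fin K by auto
    have "integrable \<mu>\<^sub>0 (\<lambda>y. y ^ k)" "(LINT y|\<mu>\<^sub>0. y ^ k) = m k" if k: "k \<in> {2..n - 1}" for k
    proof -
      have "continuous_on UNIV (\<lambda>y :: real. y ^ k)" by (intro continuous_intros)
      note lim = weak_limit_integral_dominated[OF conv fin' \<mu>\<^sub>0(1) w this K' K0 power_little_o]
      show "integrable \<mu>\<^sub>0 (\<lambda>y. y ^ k)" using lim(1) k by auto
      have "(LINT y|(\<mu> \<circ> r) i. y ^ k) = m k" for i
        using mom[of "r i"] k by (simp add: has_moments_def)
      then have "(\<lambda>i::nat. m k) \<longlonglongrightarrow> (LINT y|\<mu>\<^sub>0. y ^ k)" using lim(2) k by auto
      then show "(LINT y|\<mu>\<^sub>0. y ^ k) = m k" by (simp add: LIMSEQ_const_iff)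
    qed
    then have adm: "\<mu>\<^sub>0 \<in> ?A" using \<mu>\<^sub>0 by (auto simp: admissible_def has_moments_def)
    have f0: "finite_measure \<mu>\<^sub>0" and s0[measurable_cong]: "sets \<mu>\<^sub>0 = sets borel"
      using \<mu>\<^sub>0(1) by (auto simp: finite_measures_def)
    have "(\<integral>\<^sup>+y. ennreal (?w y) \<partial>\<mu>\<^sub>0) \<le> ennreal K"
      by (rule weak_limit_nn_integral_le[OF conv fin' \<mu>\<^sub>0(1) w K' K0])
    then have w0: "integrable \<mu>\<^sub>0 ?w"
      by (intro integrableI_nonneg) (auto simp: less_top[symmetric] top_unique)
    \<comment> \<open>Lower semicontinuity: a fixed test function bounds \<open>J\<close> from below along the sequence, and its
      integrals pass to the weak limit.\<close>
    have "(\<integral>\<^sup>+y. ennreal (?w y) \<partial>tv_measure \<nu> \<mu>\<^sub>0) \<le> ennreal c"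
    proof (rule nn_integral_tv_le_dual[OF s\<nu> f0 s0 w\<nu> w0 w(2,1)])
      fix f :: "real \<Rightarrow> real"
      assume f: "continuous_on UNIV f" "bounded (range f)" "\<And>y. \<bar>f y\<bar> \<le> ?w y"
      have [measurable]: "f \<in> borel_measurable borel" using f(1) by (rule borel_measurable_continuous_onI)
      have fint: "integrable X f" if "integrable X ?w" "sets X = sets borel" for X
        by (rule Bochner_Integration.integrable_bound[OF that(1)]) (use f(3) that(2) in \<open>auto cong: measurable_cong_sets\<close>)
      have le: "(LINT y|\<nu>. f y) - (LINT y|\<mu> i. f y) \<le> c + inverse (Suc i)" for i
      proof -
        have "ennreal ((LINT y|\<nu>. f y) - (LINT y|\<mu> i. f y)) \<le> (\<integral>\<^sup>+y. ennreal \<bar>f y\<bar> \<partial>tv_measure \<nu> (\<mu> i))"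
          by (intro integral_diff_le_tv fm fint w\<nu> w\<mu>) (auto simp: s s\<nu>)
        also have "\<dots> \<le> J n \<nu> (\<mu> i)"
          unfolding J_def using f(3) by (intro nn_integral_mono ennreal_leI)
        also have "\<dots> \<le> ennreal (c + inverse (Suc i))" using J\<mu> by (rule order_less_imp_le)
        finally show ?thesis using c by (subst (asm) ennreal_le_iff) (auto intro!: add_nonneg_nonneg)
      qed
      have "(\<lambda>i. LINT y|\<mu> (r i). f y) \<longlonglongrightarrow> (LINT y|\<mu>\<^sub>0. f y)"
        using conv f by (simp add: weakly_converges_def)
      then have 1: "(\<lambda>i. (LINT y|\<nu>. f y) - (LINT y|\<mu> (r i). f y)) \<longlonglongrightarrow> (LINT y|\<nu>. f y) - (LINT y|\<mu>\<^sub>0. f y)"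
        by (intro tendsto_intros)
      have "(\<lambda>i. c + inverse (real (Suc (r i)))) \<longlonglongrightarrow> c + 0"
        using LIMSEQ_subseq_LIMSEQ[OF LIMSEQ_inverse_real_of_nat r]
        by (intro tendsto_intros) (simp add: comp_def)
      then show "(LINT y|\<nu>. f y) - (LINT y|\<mu>\<^sub>0. f y) \<le> c"
        using le by (intro LIMSEQ_le[OF 1]) auto
    qed
    then have "J n \<nu> \<mu>\<^sub>0 \<le> I" using c by (simp add: J_def)
    then have "\<forall>\<mu>\<in>?A. J n \<nu> \<mu>\<^sub>0 \<le> J n \<nu> \<mu>" by (auto simp: I_def intro: order_trans INF_lower)
    with adm show ?thesis by blast
  qed
qed

end
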